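(* There is an absolute constant $K>0$ such that the following holds. Let $A=(a_i(j))\in\{0,1\}^{m\times n}$ be a matrix whose columns satisfy $\|A^j\|_1\le k$. Suppose there exists $\beta\le k$ such that for every $S\subseteq[n]$ and every $c>0$, the number of rows $i$ of $A$ with \[\Big|\sum_{j\in S}a_i(j)-\|a_i\|_1\cdot\frac{|S|}{n}\Big|\ge c\beta\] is at most $c^{-2}|S|$. Then $\mathrm{disc}(A)\le K(\sqrt{k}+\beta)$.
   Context: $A^j$ denotes the $j$-th column and $a_i$ the $i$-th row of $A$. For $A\in\mathbb{R}^{m\times n}$, $\mathrm{disc}(A)=\min_{x\in\{-1,1\}^n}\|Ax\|_\infty$. *)

theory Defs
  imports Complex_Main "Jordan_Normal_Form.Matrix"
begin

definition l1_norm :: "real Matrix.vec \<Rightarrow> real" where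
  "l1_norm v = (\<Sum>i<dim_vec v. \<bar>v $ i\<bar>)"

(* Inserting 0 only matters for the empty vector, whose norm is 0. *)
definition linf_norm :: "real Matrix.vec \<Rightarrow> real" where
  "linf_norm v = Max (insert 0 ((\<lambda>i. \<bar>v $ i\<bar>) ` {..<dim_vec v}))"

definition sign_vecs :: "nat \<Rightarrow> real Matrix.vec set" where
  "sign_vecs n = {x \<in> carrier_vec n. \<forall>j<n. x $ j \<in> {-1, 1}}"

definition disc :: "real Matrix.mat \<Rightarrow> real" where
  "disc A = Min ((\<lambda>x. linf_norm (A *\<^sub>v x)) ` sign_vecs (dim_col A))"

(* Min is only meaningful on finite nonempty sets; the next two facts provide this for disc. *)
lemma finite_sign_vecs: "finite (sign_vecs n)"
proof (rule finite_subset)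
  show "sign_vecs n \<subseteq> vec_of_list ` {xs. set xs \<subseteq> {-1, 1} \<and> length xs = n}"
  proof
    fix x assume x: "x \<in> sign_vecs n"
    have "set (list_of_vec x) \<subseteq> {-1, 1}"
      using x by (auto simp: sign_vecs_def set_list_of_vec vec_set_def)
    moreover have "length (list_of_vec x) = n"
      using x by (auto simp: sign_vecs_def)
    moreover have "x = vec_of_list (list_of_vec x)"
      by (simp add: vec_list)
    ultimately show "x \<in> vec_of_list ` {xs. set xs \<subseteq> {-1, 1} \<and> length xs = n}"
      by blast
  qed
  show "finite (vec_of_list ` {xs :: real list. set xs \<subseteq> {-1, 1} \<and> length xs = n})"
    by (intro finite_imageI finite_lists_length_eq) simp
qed

lemma sign_vecs_nonempty: "sign_vecs n \<noteq> {}"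
proof -
  have "Matrix.vec n (\<lambda>_. 1) \<in> sign_vecs n"
    by (simp add: sign_vecs_def)
  then show ?thesis by blast
qed

end

(* Round fractional colorings in [-1,1]^n to signs in phases. Let N coordinates be fractional (set S) and
   let e_i = |a_i|_1 N / n be the expected weight of row i on S. At most N/16 rows have e_i >= 16 k, since the
   e_i sum to at most k N, and at most N/16 rows deviate from e_i by 4 beta or more; these rows are kept
   constant. Among the others, those with e_i < beta have weight at most 5 beta on S, so they change by
   at most 10 beta from then on; the remaining ones have weight at most 5 e_i and may change by
   20 (k e_i)^(1/4). A partial coloring achieves this and halves N. As e_i halves with N, the changes form a
   geometric series with sum O(sqrt k).

   The partial coloring maximizes |x|^2 - sum_i w_i D_i(x)^4, with D_i the change of row i, over
   the compact set of admissible points. If more than N/2 coordinates were fractional, averaging the second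
   difference over an orthonormal basis of the unconstrained directions (Bessel's inequality) would
   yield a direction of increase. *)

theory Submission
  imports Defs "HOL-Analysis.Function_Topology"
begin

section \<open>Linear algebra: orthonormal solutions of homogeneous systems and an averaging
  argument\<close>

text \<open>Gaussian elimination, one equation per induction step: a nontrivial equation is solved
  for a pivot variable \<open>p\<close>, and the other equations, with \<open>p\<close> eliminated,
  go to the induction hypothesis.\<close>

lemma homogeneous_system_nonzero_solution:
  fixes f :: "'i \<Rightarrow> 'j \<Rightarrow> real"
  assumes "finite I" "finite U" "card I < card U"
  shows "\<exists>b. (\<forall>j. j \<notin> U \<longrightarrow> b j = 0) \<and> (\<exists>j\<in>U. b j \<noteq> 0) \<and> (\<forall>i\<in>I. (\<Sum>j\<in>U. f i j * b j) = 0)"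
  using assms
proof (induction I arbitrary: U f rule: finite_induct)
  case empty
  then obtain u where u: "u \<in> U" by fastforce
  show ?case
    by (rule exI[of _ "\<lambda>j. of_bool (j = u)"]) (use u in auto)
next
  case (insert i I)
  show ?case
  proof (cases "\<forall>j\<in>U. f i j = 0")
    case True
    have "card I < card U" using insert by simp
    from insert.IH[OF \<open>finite U\<close> this, of f] obtain b where
      "\<forall>j. j \<notin> U \<longrightarrow> b j = 0" "\<exists>j\<in>U. b j \<noteq> 0" "\<forall>i\<in>I. (\<Sum>j\<in>U. f i j * b j) = 0" by blast
    with True show ?thesis by (intro exI[of _ b]) simp
  next
    case False
    then obtain p where p: "p \<in> U" "f i p \<noteq> 0" by blast
    define g where "g = (\<lambda>i' j. f i' j - f i' p * f i j / f i p)"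
    have "finite (U - {p})" "card I < card (U - {p})"
      using insert p by auto
    from insert.IH[OF this, of g] obtain b where b:
      "\<forall>j. j \<notin> U - {p} \<longrightarrow> b j = 0" "\<exists>j\<in>U - {p}. b j \<noteq> 0"
      "\<forall>i'\<in>I. (\<Sum>j\<in>U - {p}. g i' j * b j) = 0" by blast
    define s where "s = (\<Sum>j\<in>U - {p}. f i j * b j)"
    \<comment> \<open>The value at \<open>p\<close> is the one that makes equation \<open>i\<close>
      hold; the elimination in \<open>g\<close> then carries the other equations over.\<close>
    define b' where "b' = b(p := - s / f i p)"
    have split: "(\<Sum>j\<in>U. h j * b' j) = (\<Sum>j\<in>U - {p}. h j * b j) - h p * s / f i p" for h :: "'j \<Rightarrow> real"
      using p \<open>finite U\<close> by (simp add: sum.remove[of U p] b'_def)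
    have "(\<Sum>j\<in>U. f i' j * b' j) = 0" if "i' \<in> insert i I" for i'
    proof (cases "i' = i")
      case True
      then show ?thesis using p by (simp add: split s_def)
    next
      case False
      then have "(\<Sum>j\<in>U - {p}. g i' j * b j) = 0" using that b by blast
      moreover have "(\<Sum>j\<in>U - {p}. g i' j * b j)
          = (\<Sum>j\<in>U - {p}. f i' j * b j) - f i' p * s / f i p"
        unfolding g_def s_def
        by (simp add: algebra_simps sum_subtractf sum_distrib_left sum_divide_distrib)
      ultimately show ?thesis by (simp add: split)
    qed
    moreover have "\<forall>j. j \<notin> U \<longrightarrow> b' j = 0" "\<exists>j\<in>U. b' j \<noteq> 0"
      using b p by (auto simp: b'_def)
    ultimately show ?thesis by blast
  qed
qed

text \<open>No Gram-Schmidt process: the vectors found so far join the system as further equations,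
  so any nonzero solution of the larger system is orthogonal to them and only has to be
  normalized.\<close>

lemma orthonormal_solutions:
  fixes f :: "'i \<Rightarrow> 'j \<Rightarrow> real"
  assumes "finite I" "finite U" "card I + v \<le> card U"
  shows "\<exists>b. (\<forall>l<v. (\<forall>j. j \<notin> U \<longrightarrow> b l j = 0) \<and> (\<forall>i\<in>I. (\<Sum>j\<in>U. f i j * b l j) = 0)) \<and>
    (\<forall>l<v. \<forall>l'<v. (\<Sum>j\<in>U. b l j * b l' j) = of_bool (l = l'))"
  using assms(3)
proof (induction v)
  case 0
  then show ?case by simp
next
  case (Suc v)
  have "card I + v \<le> card U" using Suc.prems by simp
  from Suc.IH[OF this] obtain b where b: "\<And>l j. l < v \<Longrightarrow> j \<notin> U \<Longrightarrow> b l j = 0"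
    "\<And>l i. l < v \<Longrightarrow> i \<in> I \<Longrightarrow> (\<Sum>j\<in>U. f i j * b l j) = 0"
    "\<And>l l'. l < v \<Longrightarrow> l' < v \<Longrightarrow> (\<Sum>j\<in>U. b l j * b l' j) = of_bool (l = l')"
    by blast
  have "finite (I <+> {..<v})" "card (I <+> {..<v}) < card U"
    using assms Suc.prems by (auto simp: card_Plus)
  from homogeneous_system_nonzero_solution[OF this(1) assms(2) this(2), of "case_sum f b"]
  obtain c where c: "\<forall>j. j \<notin> U \<longrightarrow> c j = 0" "\<exists>j\<in>U. c j \<noteq> 0"
    "\<forall>i\<in>I <+> {..<v}. (\<Sum>j\<in>U. case_sum f b i j * c j) = 0"
    by blast
  have fc: "(\<Sum>j\<in>U. f i j * c j) = 0" if "i \<in> I" for i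
    using bspec[OF c(3) InlI[OF that]] by simp
  have bc: "(\<Sum>j\<in>U. b l j * c j) = 0" if "l < v" for l
    using bspec[OF c(3) InrI, of l] that by simp
  define q where "q = (\<Sum>j\<in>U. c j * c j)"
  have "q > 0"
  proof -
    obtain j where "j \<in> U" "c j \<noteq> 0" using c(2) by blast
    then show ?thesis
      unfolding q_def using assms(2) by (intro sum_pos2[of U j]) (auto simp: zero_less_mult_iff)
  qed
  define e where "e = (\<lambda>j. c j / sqrt q)"
  have scale: "(\<Sum>j\<in>U. h j * e j) = (\<Sum>j\<in>U. h j * c j) / sqrt q" for h
    by (simp add: e_def sum_divide_distrib)
  have ee: "(\<Sum>j\<in>U. e j * e j) = 1"
    using \<open>q > 0\<close> by (simp add: e_def sum_divide_distrib[symmetric] q_def[symmetric])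
  have e0: "e j = 0" if "j \<notin> U" for j
    using c(1) that by (simp add: e_def)
  have fe: "(\<Sum>j\<in>U. f i j * e j) = 0" if "i \<in> I" for i
    using fc[OF that] by (simp add: scale)
  have be: "(\<Sum>j\<in>U. b l j * e j) = 0" "(\<Sum>j\<in>U. e j * b l j) = 0" if "l < v" for l
    using bc[OF that] scale[of "b l"] by (simp_all add: mult.commute)
  show ?case
    by (rule exI[of _ "b(v := e)"])
      (use b be ee e0 fe in \<open>auto simp: less_Suc_eq\<close>)
qed

text \<open>Expand the squared distance from \<open>a\<close> to its projection onto the span of the
  \<open>b l\<close>, which is nonnegative.\<close>

lemma bessel_inequality:
  fixes a :: "'j \<Rightarrow> real"
  assumes "finite L"
    and orth: "\<And>l l'. l \<in> L \<Longrightarrow> l' \<in> L \<Longrightarrow> (\<Sum>j\<in>U. b l j * b l' j) = of_bool (l = l')"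
  shows "(\<Sum>l\<in>L. (\<Sum>j\<in>U. a j * b l j)\<^sup>2) \<le> (\<Sum>j\<in>U. (a j)\<^sup>2)"
proof -
  define c where "c = (\<lambda>l. \<Sum>j\<in>U. a j * b l j)"
  have cross: "(\<Sum>j\<in>U. a j * (\<Sum>l\<in>L. c l * b l j)) = (\<Sum>l\<in>L. (c l)\<^sup>2)"
    unfolding sum_distrib_left
    by (subst sum.swap) (simp add: c_def power2_eq_square sum_distrib_left ac_simps)
  have "(\<Sum>j\<in>U. (\<Sum>l\<in>L. c l * b l j)\<^sup>2) = (\<Sum>j\<in>U. \<Sum>l\<in>L. \<Sum>l'\<in>L. c l * c l' * (b l j * b l' j))"
    by (simp add: power2_eq_square sum_product ac_simps)
  also have "\<dots> = (\<Sum>l\<in>L. \<Sum>l'\<in>L. c l * c l' * (\<Sum>j\<in>U. b l j * b l' j))"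
    by (subst sum.swap, rule sum.cong[OF refl], subst sum.swap) (simp add: sum_distrib_left)
  also have "\<dots> = (\<Sum>l\<in>L. \<Sum>l'\<in>L. if l = l' then c l * c l' else 0)"
    by (intro sum.cong refl) (simp add: orth)
  also have "\<dots> = (\<Sum>l\<in>L. (c l)\<^sup>2)"
    using assms(1) by (simp add: power2_eq_square)
  finally have sq: "(\<Sum>j\<in>U. (\<Sum>l\<in>L. c l * b l j)\<^sup>2) = (\<Sum>l\<in>L. (c l)\<^sup>2)" .
  have "0 \<le> (\<Sum>j\<in>U. (a j - (\<Sum>l\<in>L. c l * b l j))\<^sup>2)"
    by (simp add: sum_nonneg)
  also have "\<dots> = (\<Sum>j\<in>U. (a j)\<^sup>2) - (\<Sum>l\<in>L. (c l)\<^sup>2)"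
    using cross sq
    by (simp add: power2_diff sum.distrib sum_subtractf sum_distrib_left[symmetric] mult.assoc)
  finally show ?thesis by (simp add: c_def)
qed

text \<open>Take \<open>card U - card R\<close> orthonormal vectors in the kernel of the rows in
  \<open>R\<close>. If the form were at least 1 on each, its sum over them would be at least their
  number, whereas Bessel's inequality bounds that sum by the trace, which is smaller.\<close>

lemma unit_vector_small_quadratic_form:
  fixes a :: "'i \<Rightarrow> 'j \<Rightarrow> real"
  assumes "finite R" "finite U"
    and w: "\<And>i. i \<in> B \<Longrightarrow> w i \<ge> 0"
    and small: "card R + (\<Sum>i\<in>B. w i * (\<Sum>j\<in>U. (a i j)\<^sup>2)) < card U"
  shows "\<exists>b. (\<forall>j. j \<notin> U \<longrightarrow> b j = 0) \<and> (\<Sum>j\<in>U. (b j)\<^sup>2) = 1 \<and>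
    (\<forall>i\<in>R. (\<Sum>j\<in>U. a i j * b j) = 0) \<and> (\<Sum>i\<in>B. w i * (\<Sum>j\<in>U. a i j * b j)\<^sup>2) < 1"
proof -
  have "0 \<le> (\<Sum>i\<in>B. w i * (\<Sum>j\<in>U. (a i j)\<^sup>2))"
    by (intro sum_nonneg mult_nonneg_nonneg w) auto
  \<comment> \<open>The trace is nonnegative, so \<open>card R < card U\<close> and the natural
    subtraction is exact.\<close>
  with small have le: "card R + (card U - card R) \<le> card U" by linarith
  define v where "v = card U - card R"
  obtain b where b: "\<And>l j. l < v \<Longrightarrow> j \<notin> U \<Longrightarrow> b l j = 0"
    "\<And>l i. l < v \<Longrightarrow> i \<in> R \<Longrightarrow> (\<Sum>j\<in>U. a i j * b l j) = 0"
    "\<And>l l'. l < v \<Longrightarrow> l' < v \<Longrightarrow> (\<Sum>j\<in>U. b l j * b l' j) = of_bool (l = l')"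
    using orthonormal_solutions[OF assms(1,2) le, of a] unfolding v_def by blast
  have "\<exists>l<v. (\<Sum>i\<in>B. w i * (\<Sum>j\<in>U. a i j * b l j)\<^sup>2) < 1"
  proof (rule ccontr)
    assume "\<not> ?thesis"
    then have "(\<Sum>l<v. 1) \<le> (\<Sum>l<v. \<Sum>i\<in>B. w i * (\<Sum>j\<in>U. a i j * b l j)\<^sup>2)"
      by (intro sum_mono) force
    also have "\<dots> = (\<Sum>i\<in>B. w i * (\<Sum>l<v. (\<Sum>j\<in>U. a i j * b l j)\<^sup>2))"
      by (subst sum.swap) (simp add: sum_distrib_left)
    also have "\<dots> \<le> (\<Sum>i\<in>B. w i * (\<Sum>j\<in>U. (a i j)\<^sup>2))"
      by (intro sum_mono mult_left_mono w bessel_inequality) (auto simp: b)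
    finally show False using small le by (simp add: v_def of_nat_diff)
  qed
  then obtain l where "l < v" "(\<Sum>i\<in>B. w i * (\<Sum>j\<in>U. a i j * b l j)\<^sup>2) < 1" by blast
  with b show ?thesis
    by (intro exI[of _ "b l"]) (auto simp: power2_eq_square)
qed


section \<open>Partial coloring through a maximizer of a penalized energy\<close>

lemma eventually_abs_perturb_le:
  fixes u v c :: real
  assumes "\<bar>u\<bar> < v"
  shows "\<forall>\<^sub>F s in at_right 0. \<bar>u + s * c\<bar> \<le> v \<and> \<bar>u - s * c\<bar> \<le> v"
proof -
  have "((\<lambda>s. \<bar>u + s * c\<bar>) \<longlongrightarrow> \<bar>u + 0 * c\<bar>) (at_right 0)"
    "((\<lambda>s. \<bar>u - s * c\<bar>) \<longlongrightarrow> \<bar>u - 0 * c\<bar>) (at_right 0)"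
    by (intro tendsto_intros)+
  then have "\<forall>\<^sub>F s in at_right 0. \<bar>u + s * c\<bar> < v" "\<forall>\<^sub>F s in at_right 0. \<bar>u - s * c\<bar> < v"
    using assms by (auto intro!: order_tendstoD(2))
  then show ?thesis by eventually_elim auto
qed

text \<open>With N = \<open>card S\<close>, the budget is: N/8 for the rows in \<open>A\<close>,
  N/16 for the rows whose bound is attained, 3N/10 for the trace of the penalty. The total is below
  N/2, so more than N/2 fractional coordinates would leave a direction of increase.\<close>

lemma partial_coloring:
  fixes a :: "'i \<Rightarrow> 'j \<Rightarrow> real" and x0 :: "'j \<Rightarrow> real"
  assumes fin: "finite S" "finite A" "finite B"
    and x0: "\<And>j. j \<in> S \<Longrightarrow> \<bar>x0 j\<bar> \<le> 1"
    and \<Delta>: "\<And>i. i \<in> B \<Longrightarrow> \<Delta> i > 0"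
    and cardA: "real (card A) \<le> card S / 8"
    and sumB: "(\<Sum>i\<in>B. (\<Sum>j\<in>S. (a i j)\<^sup>2)\<^sup>2 / \<Delta> i ^ 4) \<le> card S / 6400"
  shows "\<exists>x. (\<forall>j\<in>S. \<bar>x j\<bar> \<le> 1) \<and> (\<forall>i\<in>A. (\<Sum>j\<in>S. a i j * (x j - x0 j)) = 0) \<and>
    (\<forall>i\<in>B. \<bar>\<Sum>j\<in>S. a i j * (x j - x0 j)\<bar> \<le> \<Delta> i) \<and> 2 * card {j \<in> S. \<bar>x j\<bar> < 1} \<le> card S"
proof -
  define D where "D = (\<lambda>i x. \<Sum>j\<in>S. a i j * (x j - x0 j))"
  \<comment> \<open>With this weight a row attaining its bound \<open>\<Delta> i\<close> costs
    exactly 16, so a total penalty of at most \<open>N\<close> allows at most \<open>N / 16\<close>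
    such rows.\<close>
  define w where "w = (\<lambda>i. 16 / \<Delta> i ^ 4)"
  define F where "F = (\<lambda>x. (\<Sum>j\<in>S. (x j)\<^sup>2) - (\<Sum>i\<in>B. w i * D i x ^ 4))"
  define N where "N = real (card S)"
  have w: "w i > 0" if "i \<in> B" for i
    using \<Delta>[OF that] by (simp add: w_def)
  have coord: "continuous_on UNIV (\<lambda>x::'j \<Rightarrow> real. x j)" for j
    by simp
  have contD: "continuous_on UNIV (D i)" for i
    unfolding D_def by (intro continuous_intros coord)
  have contF: "continuous_on UNIV F"
    unfolding F_def by (intro continuous_intros coord contD)
  \<comment> \<open>Fixing the coordinates outside \<open>S\<close> to 0 makes \<open>K\<close> a
    product of compact sets, hence compact by Tychonoff even if the type \<open>'j\<close> is
    infinite.\<close>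
  define K where "K = PiE UNIV (\<lambda>j. if j \<in> S then {-1..1} else {0::real})"
  have "compactin (product_topology (\<lambda>_. euclidean) UNIV) K"
    unfolding K_def compactin_PiE by auto
  then have "compact K" by (simp add: euclidean_product_topology)
  define C where "C = K \<inter> ((\<Inter>i\<in>A. {x. D i x = 0}) \<inter> (\<Inter>i\<in>B. {x. \<bar>D i x\<bar> \<le> \<Delta> i}))"
  have C_iff: "x \<in> C \<longleftrightarrow> (\<forall>j\<in>S. \<bar>x j\<bar> \<le> 1) \<and> (\<forall>j. j \<notin> S \<longrightarrow> x j = 0) \<and> (\<forall>i\<in>A. D i x = 0)
      \<and> (\<forall>i\<in>B. \<bar>D i x\<bar> \<le> \<Delta> i)" for x
    unfolding C_def K_def by (auto simp: PiE_iff abs_le_iff split: if_splits)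
  have "compact C"
    unfolding C_def
    by (intro compact_Int_closed \<open>compact K\<close> closed_Int closed_INT ballI closed_Collect_eq
        closed_Collect_le continuous_intros contD)
  define x1 where "x1 = (\<lambda>j. if j \<in> S then x0 j else 0)"
  have D1: "D i x1 = 0" for i by (simp add: D_def x1_def)
  have "x1 \<in> C"
    using x0 \<Delta> by (auto simp: C_iff D1 less_imp_le) (auto simp: x1_def)
  then obtain x where "x \<in> C" and xmax: "\<And>y. y \<in> C \<Longrightarrow> F y \<le> F x"
    using continuous_attains_sup[OF \<open>compact C\<close> _ continuous_on_subset[OF contF]] by blast
  then have x: "\<And>j. j \<in> S \<Longrightarrow> \<bar>x j\<bar> \<le> 1" "\<And>j. j \<notin> S \<Longrightarrow> x j = 0" "\<And>i. i \<in> A \<Longrightarrow> D i x = 0"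
    "\<And>i. i \<in> B \<Longrightarrow> \<bar>D i x\<bar> \<le> \<Delta> i"
    by (auto simp: C_iff)
  define U where "U = {j \<in> S. \<bar>x j\<bar> < 1}"
  have "U \<subseteq> S" "finite U" using fin by (auto simp: U_def)
  have "2 * card U \<le> card S"
  proof (rule ccontr)
    assume big: "\<not> ?thesis"
    then have "N > 0" using card_mono[OF fin(1) \<open>U \<subseteq> S\<close>] by (simp add: N_def)
    have "(\<Sum>j\<in>S. (x j)\<^sup>2) \<le> (\<Sum>j\<in>S. 1)"
      using x(1) by (intro sum_mono) (simp add: abs_square_le_1)
    \<comment> \<open>The starting point has no penalty, so the maximum of \<open>F\<close> is
      nonnegative and the penalty at \<open>x\<close> is at most the sum of the squares of
      \<open>x\<close> on \<open>S\<close>.\<close>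
    moreover have "0 \<le> F x1" by (simp add: F_def D1 sum_nonneg)
    ultimately have energy: "(\<Sum>i\<in>B. w i * D i x ^ 4) \<le> N"
      using xmax[OF \<open>x1 \<in> C\<close>] by (simp add: F_def N_def)
    define T where "T = {i \<in> B. \<bar>D i x\<bar> = \<Delta> i}"
    have "T \<subseteq> B" "finite T" using fin by (auto simp: T_def)
    have "16 * real (card T) = (\<Sum>i\<in>T. w i * D i x ^ 4)"
    proof -
      have "w i * D i x ^ 4 = 16" if "i \<in> T" for i
      proof -
        have "D i x ^ 4 = \<Delta> i ^ 4"
          using that power_even_abs[of 4 "D i x"] by (simp add: T_def)
        then show ?thesis using that \<Delta>[of i] by (simp add: w_def T_def)
      qed
      then show ?thesis by simp
    qed
    also have "\<dots> \<le> (\<Sum>i\<in>B. w i * D i x ^ 4)"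
      using w by (intro sum_mono2 fin \<open>T \<subseteq> B\<close>) (simp add: less_imp_le)
    finally have cardT: "real (card T) \<le> N / 16" using energy by simp
    \<comment> \<open>The factor 6 is the binomial coefficient of the quadratic term of a fourth
      power. By AM-GM, 6uv is at most (3/20)u^2 + 60v^2; the two parts are paid by the energy bound
      and by \<open>sumB\<close>, 3N/20 each, where 960 = 16 * 60.\<close>
    have "(\<Sum>i\<in>B. 6 * w i * (D i x)\<^sup>2 * (\<Sum>j\<in>U. (a i j)\<^sup>2))
        \<le> (\<Sum>i\<in>B. 3/20 * (w i * D i x ^ 4) + 960 * ((\<Sum>j\<in>S. (a i j)\<^sup>2)\<^sup>2 / \<Delta> i ^ 4))"
    proof (rule sum_mono)
      fix i assume i: "i \<in> B"
      define d where "d = (\<Sum>j\<in>S. (a i j)\<^sup>2)"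
      have "(\<Sum>j\<in>U. (a i j)\<^sup>2) \<le> d"
        unfolding d_def by (intro sum_mono2 fin \<open>U \<subseteq> S\<close>) auto
      then have "6 * w i * (D i x)\<^sup>2 * (\<Sum>j\<in>U. (a i j)\<^sup>2) \<le> 6 * w i * (D i x)\<^sup>2 * d"
        using w[OF i] by (intro mult_left_mono) auto
      also have "\<dots> = w i * (6 * (D i x)\<^sup>2 * d)" by simp
      also have "\<dots> \<le> w i * (3/20 * D i x ^ 4 + 60 * d\<^sup>2)"
      proof (intro mult_left_mono)
        have "0 \<le> 3/20 * ((D i x)\<^sup>2 - 20 * d)\<^sup>2" by simp
        then show "6 * (D i x)\<^sup>2 * d \<le> 3/20 * D i x ^ 4 + 60 * d\<^sup>2"
          by (simp add: power2_eq_square power4_eq_xxxx algebra_simps)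
      qed (use w[OF i] in simp)
      also have "\<dots> = 3/20 * (w i * D i x ^ 4) + 960 * (d\<^sup>2 / \<Delta> i ^ 4)"
        by (simp add: w_def algebra_simps)
      finally show "6 * w i * (D i x)\<^sup>2 * (\<Sum>j\<in>U. (a i j)\<^sup>2)
        \<le> 3/20 * (w i * D i x ^ 4) + 960 * (d\<^sup>2 / \<Delta> i ^ 4)" .
    qed
    also have "\<dots> \<le> 3/20 * N + 960 * (N / 6400)"
      unfolding sum.distrib sum_distrib_left[symmetric]
      using energy sumB by (intro add_mono mult_left_mono) (auto simp: N_def)
    finally have trace: "(\<Sum>i\<in>B. 6 * w i * (D i x)\<^sup>2 * (\<Sum>j\<in>U. (a i j)\<^sup>2)) \<le> 3/10 * N"
      by simp
    have "real (card (A \<union> T)) \<le> card A + card T"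
      using card_Un_le[of A T] by linarith
    moreover have "N < 2 * real (card U)" using big unfolding N_def by linarith
    ultimately have small: "real (card (A \<union> T)) + (\<Sum>i\<in>B. 6 * w i * (D i x)\<^sup>2 * (\<Sum>j\<in>U. (a i j)\<^sup>2)) < card U"
      using trace cardA cardT \<open>N > 0\<close> by (simp add: N_def)
    have "finite (A \<union> T)" using fin \<open>finite T\<close> by simp
    moreover have "0 \<le> 6 * w i * (D i x)\<^sup>2" if "i \<in> B" for i using w[OF that] by simp
    ultimately obtain b where b: "\<And>j. j \<notin> U \<Longrightarrow> b j = 0" "(\<Sum>j\<in>U. (b j)\<^sup>2) = 1"
      "\<And>i. i \<in> A \<union> T \<Longrightarrow> (\<Sum>j\<in>U. a i j * b j) = 0"
      "(\<Sum>i\<in>B. 6 * w i * (D i x)\<^sup>2 * (\<Sum>j\<in>U. a i j * b j)\<^sup>2) < 1"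
      using unit_vector_small_quadratic_form[of "A \<union> T" U B "\<lambda>i. 6 * w i * (D i x)\<^sup>2" a] small \<open>finite U\<close>
      by blast
    define p where "p = (\<lambda>i. \<Sum>j\<in>S. a i j * b j)"
    have pU: "p i = (\<Sum>j\<in>U. a i j * b j)" for i
      unfolding p_def using \<open>U \<subseteq> S\<close> fin b(1) by (intro sum.mono_neutral_right) auto
    define Q where "Q = (\<Sum>i\<in>B. w i * (6 * (D i x)\<^sup>2 * (p i)\<^sup>2))"
    have "Q < 1" using b(4) by (simp add: Q_def pU ac_simps)
    define R where "R = (\<Sum>i\<in>B. w i * p i ^ 4)"
    define y where "y = (\<lambda>s j. x j + s * b j)"
    have Dy: "D i (y s) = D i x + s * p i" for i s
      by (simp add: D_def y_def p_def algebra_simps sum.distrib sum_subtractf sum_distrib_left)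
    have sqb: "(\<Sum>j\<in>S. (b j)\<^sup>2) = 1"
      using b(1,2) \<open>U \<subseteq> S\<close> fin by (subst sum.mono_neutral_right[of S U]) auto
    \<comment> \<open>Odd powers of \<open>s\<close> cancel between \<open>y s\<close> and
      \<open>y (- s)\<close>, so no first-order condition at \<open>x\<close> is involved. As
      \<open>Q < 1\<close>, the right side is positive for small \<open>s > 0\<close>.\<close>
    have second_difference: "F (y s) + F (y (- s)) - 2 * F x = 2 * s\<^sup>2 * (1 - Q - s\<^sup>2 * R)" for s
    proof -
      have "(\<Sum>j\<in>S. (y s j)\<^sup>2) + (\<Sum>j\<in>S. (y (- s) j)\<^sup>2) - 2 * (\<Sum>j\<in>S. (x j)\<^sup>2) = 2 * s\<^sup>2 * (\<Sum>j\<in>S. (b j)\<^sup>2)"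
        unfolding sum_distrib_left sum.distrib[symmetric] sum_subtractf[symmetric]
        by (intro sum.cong refl) (simp add: y_def power2_eq_square algebra_simps)
      moreover have "(\<Sum>i\<in>B. w i * D i (y s) ^ 4) + (\<Sum>i\<in>B. w i * D i (y (- s)) ^ 4)
          - 2 * (\<Sum>i\<in>B. w i * D i x ^ 4) = 2 * s\<^sup>2 * Q + 2 * s\<^sup>2 * (s\<^sup>2 * R)"
        unfolding Q_def R_def sum_distrib_left sum.distrib[symmetric] sum_subtractf[symmetric] Dy
        by (intro sum.cong refl) (simp add: power2_eq_square power4_eq_xxxx algebra_simps)
      ultimately show ?thesis by (simp add: F_def sqb algebra_simps)
    qed
    have "\<forall>\<^sub>F s in at_right 0. \<forall>j\<in>S. \<bar>x j + s * b j\<bar> \<le> 1 \<and> \<bar>x j - s * b j\<bar> \<le> 1"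
    proof (intro eventually_ball_finite fin ballI)
      fix j assume "j \<in> S"
      show "\<forall>\<^sub>F s in at_right 0. \<bar>x j + s * b j\<bar> \<le> 1 \<and> \<bar>x j - s * b j\<bar> \<le> 1"
      proof (cases "j \<in> U")
        case True
        then show ?thesis by (intro eventually_abs_perturb_le) (simp add: U_def)
      next
        case False
        then show ?thesis using b(1) x(1)[OF \<open>j \<in> S\<close>] by simp
      qed
    qed
    \<comment> \<open>Rows in \<open>T\<close> have no slack, but \<open>b\<close> is orthogonal to
      them; all other rows in \<open>B\<close> satisfy their bound strictly.\<close>
    moreover have "\<forall>\<^sub>F s in at_right 0. \<forall>i\<in>B. \<bar>D i x + s * p i\<bar> \<le> \<Delta> i \<and> \<bar>D i x - s * p i\<bar> \<le> \<Delta> i"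
    proof (intro eventually_ball_finite fin ballI)
      fix i assume "i \<in> B"
      show "\<forall>\<^sub>F s in at_right 0. \<bar>D i x + s * p i\<bar> \<le> \<Delta> i \<and> \<bar>D i x - s * p i\<bar> \<le> \<Delta> i"
      proof (cases "i \<in> T")
        case True
        then show ?thesis using b(3)[of i] x(4)[OF \<open>i \<in> B\<close>] by (simp add: pU)
      next
        case False
        then show ?thesis
          using x(4)[OF \<open>i \<in> B\<close>] \<open>i \<in> B\<close> by (intro eventually_abs_perturb_le) (simp add: T_def)
      qed
    qed
    moreover have "\<forall>\<^sub>F s in at_right 0. s\<^sup>2 * R < 1 - Q"
    proof -
      have "((\<lambda>s. s\<^sup>2 * R) \<longlongrightarrow> 0\<^sup>2 * R) (at_right 0)" by (intro tendsto_intros)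
      then show ?thesis using \<open>Q < 1\<close> by (intro order_tendstoD(2)) auto
    qed
    moreover have "\<forall>\<^sub>F s in at_right (0::real). 0 < s"
      by (simp add: eventually_at_filter)
    ultimately have "\<forall>\<^sub>F s in at_right 0. y s \<in> C \<and> y (- s) \<in> C \<and> s\<^sup>2 * R < 1 - Q \<and> 0 < s"
    proof eventually_elim
      case (elim s)
      have "p i = 0" if "i \<in> A" for i using b(3)[of i] that by (simp add: pU)
      moreover have "b j = 0" if "j \<notin> S" for j using b(1) \<open>U \<subseteq> S\<close> that by blast
      ultimately show ?case using elim x by (simp add: C_iff Dy) (simp add: y_def)
    qed
    then obtain s where s: "y s \<in> C" "y (- s) \<in> C" "s\<^sup>2 * R < 1 - Q" "0 < s"
      using eventually_happens'[OF trivial_limit_at_right_real] by blast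
    have "0 < 2 * s\<^sup>2 * (1 - Q - s\<^sup>2 * R)" using s by simp
    then show False
      using second_difference[of s] xmax[OF s(1)] xmax[OF s(2)] by linarith
  qed
  then show ?thesis using x unfolding U_def D_def by blast
qed


section \<open>Iterated rounding under the pseudorandomness condition\<close>

text \<open>The ratio 9/10 is admissible because its fourth power exceeds 1/2. The first bound
  serves phases in which a row is kept constant, the second those in which it changes.\<close>

lemma root4_min_halving:
  fixes k p q :: real
  assumes "k > 0" "0 \<le> p" "2 * p \<le> q"
  shows "root 4 (k * min p (16 * k)) \<le> root 4 (k * min q (16 * k))"
    and "root 4 (k * min p (16 * k)) \<le> 9/10 * root 4 (k * q)"
proof -
  show "root 4 (k * min p (16 * k)) \<le> root 4 (k * min q (16 * k))"
    using assms by (intro real_root_le_mono mult_left_mono) auto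
  have "k * min p (16 * k) \<le> k * ((9/10) ^ 4 * q)"
    using assms by (intro mult_left_mono) (auto simp: power4_eq_xxxx)
  then have "root 4 (k * min p (16 * k)) \<le> root 4 ((9/10) ^ 4 * (k * q))"
    by (intro real_root_le_mono) (auto simp: ac_simps)
  also have "\<dots> = 9/10 * root 4 (k * q)"
    by (simp only: real_root_mult) (simp add: real_root_power_cancel)
  finally show "root 4 (k * min p (16 * k)) \<le> 9/10 * root 4 (k * q)" .
qed

text \<open>Induction on the number of fractional coordinates, one partial coloring per step. The
  factor 200 is 20 / (1 - 9/10), the sum of the geometric series. The cap \<open>16 * k\<close>
  reflects that a row does not change while its expected weight is above it. The term
  \<open>10 * \<beta>\<close> is paid only once, for all changes after the expected weight falls
  below \<open>\<beta>\<close>.\<close>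

lemma pseudorandom_rounding:
  fixes a :: "nat \<Rightarrow> nat \<Rightarrow> real" and x :: "nat \<Rightarrow> real" and m n :: nat
  defines "r \<equiv> \<lambda>i. \<Sum>j<n. a i j"
  assumes a01: "\<And>i j. i < m \<Longrightarrow> j < n \<Longrightarrow> a i j \<in> {0, 1}"
    and "k > 0" "\<beta> > 0" "n > 0"
    and col: "\<And>j. j < n \<Longrightarrow> (\<Sum>i<m. a i j) \<le> k"
    and pseudo: "\<And>S c. S \<subseteq> {..<n} \<Longrightarrow> c > 0 \<Longrightarrow>
      real (card {i. i < m \<and> \<bar>(\<Sum>j\<in>S. a i j) - r i * (real (card S) / real n)\<bar> \<ge> c * \<beta>})
        \<le> 1 / c\<^sup>2 * real (card S)"
    and x: "\<And>j. j < n \<Longrightarrow> \<bar>x j\<bar> \<le> 1"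
  shows "\<exists>y. (\<forall>j<n. \<bar>y j\<bar> = 1) \<and> (\<forall>j<n. \<bar>x j\<bar> = 1 \<longrightarrow> y j = x j) \<and>
    (\<forall>i<m. \<bar>\<Sum>j<n. a i j * (y j - x j)\<bar>
      \<le> 200 * root 4 (k * min (r i * (real (card {j. j < n \<and> \<bar>x j\<bar> < 1}) / real n)) (16 * k)) + 10 * \<beta>)"
  using x
proof (induction "card {j. j < n \<and> \<bar>x j\<bar> < 1}" arbitrary: x rule: less_induct)
  case less
  define S where "S = {j. j < n \<and> \<bar>x j\<bar> < 1}"
  define N where "N = real (card S)"
  have S: "S \<subseteq> {..<n}" "finite S" by (auto simp: S_def)
  have a0: "0 \<le> a i j" if "i < m" "j < n" for i j
    using a01[OF that] by auto
  have r0: "0 \<le> r i" if "i < m" for i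
    unfolding r_def using a0 that by (intro sum_nonneg) auto
  have off: "\<bar>x j\<bar> = 1" if "j < n" "j \<notin> S" for j
    using that less.prems[of j] by (auto simp: S_def)
  show ?case
  proof (cases "S = {}")
    case True
    have "0 \<le> 200 * root 4 (k * min (r i * (real (card S) / real n)) (16 * k)) + 10 * \<beta>" if "i < m" for i
      using r0[OF that] \<open>k > 0\<close> \<open>\<beta> > 0\<close> by simp
    moreover have "\<bar>x j\<bar> = 1" if "j < n" for j using off[OF that] True by simp
    ultimately show ?thesis unfolding S_def by (intro exI[of _ x]) simp
  next
    case False
    then have "N > 0" using S by (simp add: N_def card_gt_0_iff)
    define e where "e = (\<lambda>i. r i * (N / n))"
    \<comment> \<open>\<open>P\<close> is bounded by Markov's inequality and the column sums,
      \<open>V\<close> by \<open>pseudo\<close> with c = 4. Rows outside \<open>P\<close>,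
      \<open>V\<close> and \<open>B\<close> have expected weight below
      \<open>\<beta>\<close>.\<close>
    define P where "P = {i. i < m \<and> 16 * k \<le> e i}"
    define V where "V = {i. i < m \<and> \<bar>(\<Sum>j\<in>S. a i j) - e i\<bar> \<ge> 4 * \<beta>}"
    define B where "B = {i. i < m \<and> i \<notin> P \<union> V \<and> \<beta> \<le> e i}"
    have e0: "0 \<le> e i" if "i < m" for i
      using r0[OF that] \<open>N > 0\<close> by (simp add: e_def)
    have "(\<Sum>i<m. r i) = (\<Sum>j<n. \<Sum>i<m. a i j)"
      unfolding r_def by (rule sum.swap)
    also have "\<dots> \<le> (\<Sum>j<n. k)" using col by (intro sum_mono) simp
    finally have "(\<Sum>i<m. r i) * (N / n) \<le> n * k * (N / n)"
      using \<open>N > 0\<close> by (intro mult_right_mono) auto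
    then have sum_e: "(\<Sum>i<m. e i) \<le> N * k"
      using \<open>n > 0\<close> by (simp add: e_def mult.commute[of N k] flip: sum_distrib_right sum_divide_distrib)
    have "16 * k * card P = (\<Sum>i\<in>P. 16 * k)" by simp
    also have "\<dots> \<le> (\<Sum>i\<in>P. e i)" by (intro sum_mono) (simp add: P_def)
    also have "\<dots> \<le> (\<Sum>i<m. e i)" using e0 by (intro sum_mono2) (auto simp: P_def)
    finally have "k * (16 * card P) \<le> k * N" using sum_e by (simp add: ac_simps)
    then have cardP: "card P \<le> N / 16" using \<open>k > 0\<close> by simp
    have cardV: "card V \<le> N / 16"
      using pseudo[OF S(1), of 4] by (simp add: V_def e_def N_def)
    have fin: "finite P" "finite V" "finite B" by (auto simp: P_def V_def B_def)
    \<comment> \<open>A row in \<open>B\<close> has weight at most \<open>e i + 4 * \<beta>\<close>,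
      hence at most \<open>5 * e i\<close>. Since 20^4 = 160000, its term in \<open>sumB\<close> is
      at most 25 e^2 / (160000 k e) = e / (6400 k), and the \<open>e i\<close> sum to at most
      \<open>N * k\<close>.\<close>
    define \<Delta> where "\<Delta> = (\<lambda>i. 20 * root 4 (k * e i))"
    have \<Delta>: "0 < \<Delta> i" if "i \<in> B" for i
      using that \<open>k > 0\<close> \<open>\<beta> > 0\<close> by (auto simp: B_def \<Delta>_def)
    have "(\<Sum>i\<in>B. (\<Sum>j\<in>S. (a i j)\<^sup>2)\<^sup>2 / \<Delta> i ^ 4) \<le> (\<Sum>i\<in>B. e i / (6400 * k))"
    proof (rule sum_mono)
      fix i assume i: "i \<in> B"
      have "e i > 0" using i \<open>\<beta> > 0\<close> by (auto simp: B_def)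
      have "(\<Sum>j\<in>S. (a i j)\<^sup>2) = (\<Sum>j\<in>S. a i j)"
        using a01[of i] i S by (intro sum.cong) (force simp: B_def)+
      moreover have "(\<Sum>j\<in>S. a i j) \<le> 5 * e i"
        using i by (auto simp: B_def V_def)
      moreover have "0 \<le> (\<Sum>j\<in>S. (a i j)\<^sup>2)" by (simp add: sum_nonneg)
      ultimately have "(\<Sum>j\<in>S. (a i j)\<^sup>2)\<^sup>2 \<le> (5 * e i)\<^sup>2" by (intro power_mono) auto
      moreover have "\<Delta> i ^ 4 = 160000 * (k * e i)"
        using \<open>k > 0\<close> \<open>e i > 0\<close> by (simp add: \<Delta>_def power_mult_distrib)
      ultimately have "(\<Sum>j\<in>S. (a i j)\<^sup>2)\<^sup>2 / \<Delta> i ^ 4 \<le> (5 * e i)\<^sup>2 / (160000 * (k * e i))"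
        using \<open>k > 0\<close> \<open>e i > 0\<close> by (simp only:) (intro divide_right_mono, auto)
      also have "\<dots> = e i / (6400 * k)"
        using \<open>k > 0\<close> \<open>e i > 0\<close> by (simp add: field_simps power2_eq_square)
      finally show "(\<Sum>j\<in>S. (a i j)\<^sup>2)\<^sup>2 / \<Delta> i ^ 4 \<le> e i / (6400 * k)" .
    qed
    also have "\<dots> \<le> (\<Sum>i<m. e i / (6400 * k))"
      using e0 \<open>k > 0\<close> by (intro sum_mono2) (auto simp: B_def)
    also have "\<dots> \<le> N * k / (6400 * k)"
      unfolding sum_divide_distrib[symmetric] using sum_e \<open>k > 0\<close> by (intro divide_right_mono) auto
    finally have sumB: "(\<Sum>i\<in>B. (\<Sum>j\<in>S. (a i j)\<^sup>2)\<^sup>2 / \<Delta> i ^ 4) \<le> card S / 6400"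
      using \<open>k > 0\<close> by (simp add: N_def)
    have "real (card (P \<union> V)) \<le> card P + card V"
      using card_Un_le[of P V] by linarith
    then have cardA: "real (card (P \<union> V)) \<le> card S / 8"
      using cardP cardV by (simp add: N_def)
    have "finite (P \<union> V)" using fin by simp
    have "\<bar>x j\<bar> \<le> 1" if "j \<in> S" for j using that by (simp add: S_def)
    note partial_coloring[OF S(2) \<open>finite (P \<union> V)\<close> fin(3) this \<Delta> cardA sumB]
    then obtain z where "(\<forall>j\<in>S. \<bar>z j\<bar> \<le> 1) \<and> (\<forall>i\<in>P \<union> V. (\<Sum>j\<in>S. a i j * (z j - x j)) = 0) \<and>
      (\<forall>i\<in>B. \<bar>\<Sum>j\<in>S. a i j * (z j - x j)\<bar> \<le> \<Delta> i) \<and> 2 * card {j \<in> S. \<bar>z j\<bar> < 1} \<le> card S"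
      by (rule exE)
    then have z: "\<And>j. j \<in> S \<Longrightarrow> \<bar>z j\<bar> \<le> 1"
      "\<And>i. i \<in> P \<union> V \<Longrightarrow> (\<Sum>j\<in>S. a i j * (z j - x j)) = 0"
      "\<And>i. i \<in> B \<Longrightarrow> \<bar>\<Sum>j\<in>S. a i j * (z j - x j)\<bar> \<le> \<Delta> i"
      "2 * card {j \<in> S. \<bar>z j\<bar> < 1} \<le> card S"
      by blast+
    define x' where "x' = (\<lambda>j. if j \<in> S then z j else x j)"
    define N' where "N' = real (card {j. j < n \<and> \<bar>x' j\<bar> < 1})"
    have "{j. j < n \<and> \<bar>x' j\<bar> < 1} = {j \<in> S. \<bar>z j\<bar> < 1}"
      by (auto simp: x'_def S_def)
    then have halved: "2 * card {j. j < n \<and> \<bar>x' j\<bar> < 1} \<le> card S" using z(4) by simp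
    then have half: "2 * N' \<le> N" by (simp add: N'_def N_def flip: of_nat_mult)
    have smaller: "card {j. j < n \<and> \<bar>x' j\<bar> < 1} < card {j. j < n \<and> \<bar>x j\<bar> < 1}"
      using halved \<open>N > 0\<close> unfolding N_def S_def by simp
    have "\<bar>x' j\<bar> \<le> 1" if "j < n" for j
      using z(1) less.prems[OF that] by (simp add: x'_def)
    from less.hyps[OF smaller this] obtain y where y: "\<And>j. j < n \<Longrightarrow> \<bar>y j\<bar> = 1"
      "\<And>j. j < n \<Longrightarrow> \<bar>x' j\<bar> = 1 \<Longrightarrow> y j = x' j"
      "\<And>i. i < m \<Longrightarrow> \<bar>\<Sum>j<n. a i j * (y j - x' j)\<bar>
        \<le> 200 * root 4 (k * min (r i * (N' / n)) (16 * k)) + 10 * \<beta>"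
      unfolding N'_def by blast
    \<comment> \<open>Coordinates outside \<open>S\<close> are already signs, and both the partial
      coloring and the induction hypothesis preserve them.\<close>
    have yx: "y j = x j" if "j < n" "j \<notin> S" for j
      using y(2)[OF that(1)] off[OF that] that by (simp add: x'_def)
    have bound: "\<bar>\<Sum>j<n. a i j * (y j - x j)\<bar> \<le> 200 * root 4 (k * min (e i) (16 * k)) + 10 * \<beta>"
      if i: "i < m" for i
    proof -
      have "0 \<le> r i * (N' / n)" using r0[OF i] by (simp add: N'_def)
      moreover have "2 * (r i * (N' / n)) \<le> e i"
      proof -
        have "2 * (r i * (N' / n)) = r i / n * (2 * N')" by simp
        also have "\<dots> \<le> r i / n * N" using r0[OF i] half by (intro mult_left_mono) auto
        also have "\<dots> = e i" by (simp add: e_def)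
        finally show ?thesis .
      qed
      ultimately have mono: "root 4 (k * min (r i * (N' / n)) (16 * k)) \<le> root 4 (k * min (e i) (16 * k))"
        "root 4 (k * min (r i * (N' / n)) (16 * k)) \<le> 9/10 * root 4 (k * e i)"
        by (rule root4_min_halving[OF \<open>k > 0\<close>])+
      have "(\<Sum>j<n. a i j * (y j - x j)) = (\<Sum>j<n. a i j * (y j - x' j)) + (\<Sum>j<n. a i j * (x' j - x j))"
        by (simp add: sum.distrib[symmetric] algebra_simps)
      also have "(\<Sum>j<n. a i j * (x' j - x j)) = (\<Sum>j\<in>S. a i j * (z j - x j))"
        using S by (intro sum.mono_neutral_cong_right) (auto simp: x'_def)
      finally have split: "(\<Sum>j<n. a i j * (y j - x j))
        = (\<Sum>j<n. a i j * (y j - x' j)) + (\<Sum>j\<in>S. a i j * (z j - x j))" .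
      consider "i \<in> P \<union> V" | "i \<in> B" | "i \<notin> P \<union> V" "e i < \<beta>"
        using i by (force simp: B_def)
      then show ?thesis
      proof cases
        case 1
        have "\<bar>\<Sum>j<n. a i j * (y j - x j)\<bar> \<le> 200 * root 4 (k * min (r i * (N' / n)) (16 * k)) + 10 * \<beta>"
          using y(3)[OF i] unfolding split z(2)[OF 1] by simp
        also have "\<dots> \<le> 200 * root 4 (k * min (e i) (16 * k)) + 10 * \<beta>"
          using mono(1) by (intro add_right_mono mult_left_mono) simp_all
        finally show ?thesis .
      next
        case 2
        then have "min (e i) (16 * k) = e i" by (auto simp: B_def P_def)
        have "\<bar>\<Sum>j<n. a i j * (y j - x j)\<bar>
            \<le> \<bar>\<Sum>j<n. a i j * (y j - x' j)\<bar> + \<bar>\<Sum>j\<in>S. a i j * (z j - x j)\<bar>"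
          unfolding split by (rule abs_triangle_ineq)
        also have "\<dots> \<le> 200 * root 4 (k * min (r i * (N' / n)) (16 * k)) + 10 * \<beta> + \<Delta> i"
          by (rule add_mono[OF y(3)[OF i] z(3)[OF 2]])
        \<comment> \<open>The geometric series closes: 200 * 9/10 for the later phases plus 20 for
          this one is 200 again.\<close>
        also have "\<dots> \<le> 200 * (9/10 * root 4 (k * e i)) + 10 * \<beta> + \<Delta> i"
          using mono(2) by (intro add_right_mono mult_left_mono) simp_all
        also have "\<dots> = 200 * root 4 (k * min (e i) (16 * k)) + 10 * \<beta>"
          unfolding \<open>min (e i) (16 * k) = e i\<close> \<Delta>_def by simp
        finally show ?thesis .
      next
        case 3
        \<comment> \<open>Expected weight below \<open>\<beta>\<close> plus deviation below
          \<open>4 * \<beta>\<close>. The whole remaining change is bounded directly, at most 2 per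
          coordinate, without the bound from the induction hypothesis.\<close>
        have "(\<Sum>j\<in>S. a i j) \<le> 5 * \<beta>"
          using 3 i by (auto simp: V_def)
        have "(\<Sum>j<n. a i j * (y j - x j)) = (\<Sum>j\<in>S. a i j * (y j - x j))"
          using S yx by (intro sum.mono_neutral_right) auto
        also have "\<bar>\<dots>\<bar> \<le> (\<Sum>j\<in>S. \<bar>a i j * (y j - x j)\<bar>)" by (rule sum_abs)
        also have "\<dots> \<le> (\<Sum>j\<in>S. a i j * 2)"
        proof (intro sum_mono)
          fix j assume "j \<in> S"
          then have "j < n" using S by auto
          then have "\<bar>y j - x j\<bar> \<le> 2" using y(1) less.prems[of j] by (smt (verit))
          then show "\<bar>a i j * (y j - x j)\<bar> \<le> a i j * 2"
            using a0[OF i \<open>j < n\<close>] by (simp add: abs_mult mult_left_mono)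
        qed
        also have "\<dots> \<le> 10 * \<beta>"
          unfolding sum_distrib_right[symmetric] using \<open>(\<Sum>j\<in>S. a i j) \<le> 5 * \<beta>\<close> by simp
        also have "\<dots> \<le> 200 * root 4 (k * min (e i) (16 * k)) + 10 * \<beta>"
          using e0[OF i] \<open>k > 0\<close> by simp
        finally show ?thesis .
      qed
    qed
    have "y j = x j" if "j < n" "\<bar>x j\<bar> = 1" for j
      using yx that by (simp add: S_def)
    then show ?thesis
      using y(1) bound unfolding e_def N_def S_def by (intro exI[of _ y]) blast
  qed
qed

section \<open>From the rounding to the discrepancy bound\<close>

lemma disc_le_if_sign_vec:
  assumes "A \<in> carrier_mat m n" "\<And>j. j < n \<Longrightarrow> \<bar>y j\<bar> = 1" "0 \<le> t"
    and "\<And>i. i < m \<Longrightarrow> \<bar>\<Sum>j<n. A $$ (i, j) * y j\<bar> \<le> t"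
  shows "disc A \<le> t"
proof -
  define v where "v = Matrix.vec n y"
  have "y j = 1 \<or> y j = - 1" if "j < n" for j
    using assms(2)[OF that] by linarith
  then have "v \<in> sign_vecs (dim_col A)"
    using assms(1) by (force simp: v_def sign_vecs_def)
  then have "disc A \<le> linf_norm (A *\<^sub>v v)"
    unfolding disc_def by (intro Min_le finite_imageI finite_sign_vecs) simp
  also have "\<dots> \<le> t"
    unfolding linf_norm_def using assms
    by (subst Max_le_iff) (auto simp: v_def scalar_prod_def atLeast0LessThan)
  finally show ?thesis .
qed

text \<open>Rounding the zero vector gives a sign vector, and the cap \<open>16 * k\<close> turns
  the fourth root into at most \<open>2 * sqrt k\<close>. The constant 400 is 200 * 2, which also
  covers the 10 in front of \<open>\<beta>\<close>.\<close>

theorem theorem6: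
  shows "\<exists>K>0. \<forall>(m::nat) (n::nat) (A::real Matrix.mat) (k::real) (\<beta>::real).
    0 < m \<longrightarrow> 0 < n \<longrightarrow>
    A \<in> carrier_mat m n \<longrightarrow>
    (\<forall>i<m. \<forall>j<n. A $$ (i, j) \<in> {0, 1}) \<longrightarrow>
    (\<forall>j<n. l1_norm (Matrix.col A j) \<le> k) \<longrightarrow>
    \<beta> \<le> k \<longrightarrow>
    (\<forall>S\<subseteq>{..<n}. \<forall>c>0.
        real (card {i. i < m \<and>
          \<bar>(\<Sum>j\<in>S. A $$ (i, j)) - l1_norm (Matrix.row A i) * (real (card S) / real n)\<bar> \<ge> c * \<beta>})
        \<le> 1 / c\<^sup>2 * real (card S)) \<longrightarrow>
    disc A \<le> K * (sqrt k + \<beta>)"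
proof (intro exI[of _ 400] conjI allI impI)
  fix m n :: nat and A :: "real Matrix.mat" and k \<beta> :: real
  assume "0 < m" "0 < n" and A: "A \<in> carrier_mat m n"
    and A01: "\<forall>i<m. \<forall>j<n. A $$ (i, j) \<in> {0, 1}"
    and col: "\<forall>j<n. l1_norm (Matrix.col A j) \<le> k"
    and "\<beta> \<le> k"
    and pseudo: "\<forall>S\<subseteq>{..<n}. \<forall>c>0.
        real (card {i. i < m \<and>
          \<bar>(\<Sum>j\<in>S. A $$ (i, j)) - l1_norm (Matrix.row A i) * (real (card S) / real n)\<bar> \<ge> c * \<beta>})
        \<le> 1 / c\<^sup>2 * real (card S)"
  \<comment> \<open>Apply the hypothesis to the empty set with c = 1: if \<open>\<beta>\<close> were
    not positive, all \<open>m\<close> rows would be counted, against a bound of 0.\<close>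
  have "\<beta> > 0"
  proof (rule ccontr)
    assume "\<not> \<beta> > 0"
    then have "{i. i < m \<and> \<bar>(\<Sum>j\<in>({}::nat set). A $$ (i, j)) - l1_norm (Matrix.row A i) * (real (card ({}::nat set)) / real n)\<bar> \<ge> 1 * \<beta>}
      = {..<m}" by auto
    moreover have "real (card {i. i < m \<and> \<bar>(\<Sum>j\<in>({}::nat set). A $$ (i, j))
        - l1_norm (Matrix.row A i) * (real (card ({}::nat set)) / real n)\<bar> \<ge> 1 * \<beta>}) \<le> 1 / 1\<^sup>2 * real (card ({}::nat set))"
      by (intro pseudo[rule_format]) auto
    ultimately have "real (card {..<m}) \<le> 0" by simp
    with \<open>0 < m\<close> show False by simp
  qed
  with \<open>\<beta> \<le> k\<close> have "k > 0" by simp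
  define a where "a = (\<lambda>i j. A $$ (i, j))"
  have abs_a: "\<bar>A $$ (i, j)\<bar> = a i j" if "i < m" "j < n" for i j
    using A01 that by (force simp: a_def)
  have row: "l1_norm (Matrix.row A i) = (\<Sum>j<n. a i j)" if "i < m" for i
    using A that by (auto simp: l1_norm_def abs_a intro!: sum.cong)
  have colsum: "(\<Sum>i<m. a i j) \<le> k" if "j < n" for j
  proof -
    have "l1_norm (Matrix.col A j) = (\<Sum>i<m. a i j)"
      using A that by (auto simp: l1_norm_def abs_a intro!: sum.cong)
    with col that show ?thesis by force
  qed
  have "real (card {i. i < m \<and> \<bar>(\<Sum>j\<in>S. a i j) - (\<Sum>j<n. a i j) * (real (card S) / real n)\<bar> \<ge> c * \<beta>})
      \<le> 1 / c\<^sup>2 * real (card S)" if "S \<subseteq> {..<n}" "c > 0" for S c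
  proof -
    have "{i. i < m \<and> \<bar>(\<Sum>j\<in>S. a i j) - (\<Sum>j<n. a i j) * (real (card S) / real n)\<bar> \<ge> c * \<beta>}
      = {i. i < m \<and>
          \<bar>(\<Sum>j\<in>S. A $$ (i, j)) - l1_norm (Matrix.row A i) * (real (card S) / real n)\<bar> \<ge> c * \<beta>}"
      by (auto simp: row) (simp_all add: a_def)
    with pseudo that show ?thesis by simp
  qed
  \<comment> \<open>All coordinates of the zero vector are fractional, so the density of the
    fractional set is \<open>real n / real n\<close>.\<close>
  from pseudorandom_rounding[of m n a k \<beta> "\<lambda>_. 0", OF _ \<open>k > 0\<close> \<open>\<beta> > 0\<close> \<open>0 < n\<close> colsum this] A01
  obtain y where y: "\<And>j. j < n \<Longrightarrow> \<bar>y j\<bar> = 1"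
    "\<And>i. i < m \<Longrightarrow> \<bar>\<Sum>j<n. a i j * y j\<bar>
      \<le> 200 * root 4 (k * min ((\<Sum>j<n. a i j) * (real n / real n)) (16 * k)) + 10 * \<beta>"
    by (auto simp: a_def)
  have root: "root 4 (k * min t (16 * k)) \<le> 2 * sqrt k" for t
  proof -
    have "(2 * sqrt k) ^ 4 = k * (16 * k)"
      using \<open>k > 0\<close> by (simp add: power4_eq_xxxx)
    moreover have "k * min t (16 * k) \<le> k * (16 * k)"
      using \<open>k > 0\<close> by (intro mult_left_mono) auto
    ultimately have "root 4 (k * min t (16 * k)) \<le> root 4 ((2 * sqrt k) ^ 4)"
      by (intro real_root_le_mono) auto
    also have "\<dots> = 2 * sqrt k"
      using \<open>k > 0\<close> by (intro real_root_power_cancel) auto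
    finally show ?thesis .
  qed
  show "disc A \<le> 400 * (sqrt k + \<beta>)"
  proof (rule disc_le_if_sign_vec[OF A y(1)])
    show "0 \<le> 400 * (sqrt k + \<beta>)" using \<open>k > 0\<close> \<open>\<beta> > 0\<close> by simp
    show "\<bar>\<Sum>j<n. A $$ (i, j) * y j\<bar> \<le> 400 * (sqrt k + \<beta>)" if "i < m" for i
      using y(2)[OF that] root[of "(\<Sum>j<n. a i j) * (real n / real n)"] \<open>\<beta> > 0\<close> unfolding a_def by (simp add: algebra_simps)
  qed
qed simp

end
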